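(* Let $x_0\ge 0$ be an integer, let $\lambda_0, s_0$ be functions on the integers $x\ge x_0$, and define functions $\lambda_k, s_k$ for $k\ge 1$ recursively by $$\lambda_k(x)=\Delta \lambda_{k-1}(x)+\lambda_{k-1}(x+1)\lambda_0(x)+s_{k-1}(x+1),\qquad s_k(x)=\Delta s_{k-1}(x)+\lambda_{k-1}(x+1)s_0(x).$$ Let $n\ge 1$ be an integer. If, for all integers $x\ge x_0$, $s_n(x)\lambda_{n-1}(x)\neq 0$ and $$\lambda_{n-1}(x)s_n(x)-\lambda_n(x)s_{n-1}(x)=0,$$ then the difference equation $$\Delta^2 y(x)=\lambda_0(x)\,\Delta y(x)+s_0(x)\,y(x)$$ has a polynomial solution whose degree is at most $n$.
   Context: $\Delta$ is the forward difference operator, $\Delta f(x)=f(x+1)-f(x)$, and $\Delta^2=\Delta\circ\Delta$. Functions are real (or complex) valued. The difference equation is considered for integers $x\ge x_0$; a polynomial solution is a not identically zero solution that is the restriction to these integers of a polynomial in $x$. *)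

theory Defs
  imports Complex_Main "HOL-Computational_Algebra.Polynomial"
begin

definition fdiff :: "(int \<Rightarrow> 'a::ab_group_add) \<Rightarrow> int \<Rightarrow> 'a" where
  "fdiff f x = f (x + 1) - f x"

(* Functions on the integers x >= x0 are represented by total functions on int.
   The values of lam and sseq at x depend on l0 and s0 only at points >= x, so
   values below x0 play no role for x >= x0. *)
fun lam :: "(int \<Rightarrow> 'a::comm_ring_1) \<Rightarrow> (int \<Rightarrow> 'a) \<Rightarrow> nat \<Rightarrow> int \<Rightarrow> 'a"
  and sseq :: "(int \<Rightarrow> 'a::comm_ring_1) \<Rightarrow> (int \<Rightarrow> 'a) \<Rightarrow> nat \<Rightarrow> int \<Rightarrow> 'a" where
  "lam l0 s0 0 x = l0 x"
| "lam l0 s0 (Suc k) x =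
     fdiff (lam l0 s0 k) x + lam l0 s0 k (x + 1) * l0 x + sseq l0 s0 k (x + 1)"
| "sseq l0 s0 0 x = s0 x"
| "sseq l0 s0 (Suc k) x = fdiff (sseq l0 s0 k) x + lam l0 s0 k (x + 1) * s0 x"

definition solves_diff_eq ::
    "int \<Rightarrow> (int \<Rightarrow> 'a::comm_ring_1) \<Rightarrow> (int \<Rightarrow> 'a) \<Rightarrow> (int \<Rightarrow> 'a) \<Rightarrow> bool" where
  "solves_diff_eq x0 l0 s0 y \<longleftrightarrow>
     (\<forall>x\<ge>x0. fdiff (fdiff y) x = l0 x * fdiff y x + s0 x * y x)"

definition polynomial_solution ::
    "int \<Rightarrow> (int \<Rightarrow> 'a::comm_ring_1) \<Rightarrow> (int \<Rightarrow> 'a) \<Rightarrow> 'a poly \<Rightarrow> bool" where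
  "polynomial_solution x0 l0 s0 p \<longleftrightarrow>
     solves_diff_eq x0 l0 s0 (\<lambda>x. poly p (of_int x)) \<and>
     (\<exists>x\<ge>x0. poly p (of_int x) \<noteq> 0)"

end

theory Submission
  imports Defs
begin

text \<open>
  Every solution \<open>y\<close> satisfies \<open>\<Delta>\<^sup>k\<^sup>+\<^sup>2 y = \<lambda>\<^sub>k \<Delta>y + s\<^sub>k y\<close>. Put \<open>a = s\<^sub>n\<^sub>-\<^sub>1 / \<lambda>\<^sub>n\<^sub>-\<^sub>1\<close> and let \<open>y\<close> solve the
  first-order equation \<open>\<Delta>y = - a y\<close> with \<open>y(x\<^sub>0) = 1\<close>. The termination condition says
  \<open>s\<^sub>n = a \<lambda>\<^sub>n\<close>; expanding \<open>s\<^sub>n\<close> and \<open>\<lambda>\<^sub>n\<close> by the recursion and cancelling \<open>\<lambda>\<^sub>n\<^sub>-\<^sub>1(x+1)\<close> turns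
  this into the Riccati equation for \<open>a\<close> which expresses that \<open>y\<close> solves the second-order
  equation. Hence \<open>\<Delta>\<^sup>n\<^sup>+\<^sup>1 y = \<lambda>\<^sub>n\<^sub>-\<^sub>1 (\<Delta>y + a y) = 0\<close>, and Newton's forward difference formula
  shows that \<open>y\<close> is a polynomial of degree at most \<open>n\<close>.
\<close>

text \<open>Induction on \<open>k\<close>: differencing the formula and eliminating
  \<open>fdiff y (x + 1)\<close> by the equation and \<open>y (x + 1)\<close> by the definition of
  \<open>fdiff\<close> produces exactly the recursion of \<open>lam\<close> and
  \<open>sseq\<close>.\<close>

lemma fdiff_iterate_solution:
  assumes "solves_diff_eq x0 l0 s0 y" and "x \<ge> x0"
  shows "(fdiff ^^ (k + 2)) y x = lam l0 s0 k x * fdiff y x + sseq l0 s0 k x * y x"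
  using \<open>x \<ge> x0\<close>
proof (induction k arbitrary: x)
  case 0
  then show ?case
    using assms(1) by (simp add: solves_diff_eq_def numeral_2_eq_2)
next
  case (Suc k)
  let ?L = "lam l0 s0 k" and ?S = "sseq l0 s0 k"
  have second: "fdiff y (x + 1) = fdiff y x + (l0 x * fdiff y x + s0 x * y x)"
    using assms(1) Suc.prems unfolding solves_diff_eq_def
    by (metis fdiff_def add_diff_cancel_left' diff_add_cancel)
  have first: "y (x + 1) = y x + fdiff y x"
    by (simp add: fdiff_def)
  have "(fdiff ^^ (Suc k + 2)) y x = (fdiff ^^ (k + 2)) y (x + 1) - (fdiff ^^ (k + 2)) y x"
    by (simp add: fdiff_def)
  also have "\<dots> = ?L (x + 1) * fdiff y (x + 1) + ?S (x + 1) * y (x + 1)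
      - (?L x * fdiff y x + ?S x * y x)"
    using Suc by simp
  also have "\<dots> = lam l0 s0 (Suc k) x * fdiff y x + sseq l0 s0 (Suc k) x * y x"
    unfolding second first lam.simps sseq.simps fdiff_def[of ?L] fdiff_def[of ?S]
    by (simp add: algebra_simps)
  finally show ?case .
qed

text \<open>The induction hypothesis for \<open>fdiff f\<close> expands the differences of
  \<open>f\<close>; summing them from \<open>x0\<close> upwards raises each binomial index by one,
  by Pascal's rule.\<close>

lemma newton_forward_difference:
  fixes f :: "int \<Rightarrow> 'a::field_char_0"
  assumes "\<And>x. x \<ge> x0 \<Longrightarrow> (fdiff ^^ m) f x = 0" and "x \<ge> x0"
  shows "f x = (\<Sum>j<m. (fdiff ^^ j) f x0 * (of_int (x - x0) gchoose j))"
  using assms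
proof (induction m arbitrary: f x)
  case 0
  then show ?case by simp
next
  case (Suc m)
  have diff: "fdiff f z = (\<Sum>j<m. (fdiff ^^ Suc j) f x0 * (of_int (z - x0) gchoose j))"
    if "z \<ge> x0" for z
    using Suc.IH[of "fdiff f" z] Suc.prems(1) that by (simp add: funpow_Suc_right del: funpow.simps)
  show ?case
    using \<open>x \<ge> x0\<close>
  proof (induction x rule: int_ge_induct)
    case base
    show ?case by (simp add: sum.lessThan_Suc_shift del: sum.lessThan_Suc)
  next
    case (step z)
    have shift: "(of_int (z + 1 - x0) :: 'a) = of_int (z - x0) + 1"
      by simp
    have "f (z + 1) = f z + fdiff f z"
      by (simp add: fdiff_def)
    also have "\<dots> = f x0 + (\<Sum>j<m. (fdiff ^^ Suc j) f x0 *
        ((of_int (z - x0) gchoose j) + (of_int (z - x0) gchoose Suc j)))"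
      unfolding step.IH diff[OF step.hyps] sum.lessThan_Suc_shift distrib_left sum.distrib
      by (simp add: add_ac del: funpow.simps of_int_diff)
    also have "\<dots> = (\<Sum>j<Suc m. (fdiff ^^ j) f x0 * (of_int (z + 1 - x0) gchoose j))"
      unfolding shift gbinomial_Suc_Suc[symmetric] sum.lessThan_Suc_shift by simp
    finally show ?case .
  qed
qed

text \<open>Supplies the Newton basis centred at \<open>c\<close>, as falling factorials divided by
  \<open>fact k\<close>.\<close>

lemma ex_poly_gbinomial_shift:
  fixes c :: "'a::field_char_0"
  shows "\<exists>p. degree p \<le> k \<and> (\<forall>z. poly p z = ((z - c) gchoose k))"
proof (intro exI conjI allI)
  let ?q = "\<Prod>i<k. [:- c - of_nat i, 1:]"
  have "degree ?q \<le> (\<Sum>i<k. degree [:- c - of_nat i, 1:])"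
    by (rule degree_prod_sum_le[unfolded o_def]) simp
  then show "degree (smult (inverse (fact k)) ?q) \<le> k"
    by simp
  show "poly (smult (inverse (fact k)) ?q) z = ((z - c) gchoose k)" for z
    by (simp add: poly_prod gbinomial_prod_rev divide_inverse lessThan_atLeast0 algebra_simps)
qed

lemma fdiff_iterate_zero_imp_poly:
  fixes f :: "int \<Rightarrow> 'a::field_char_0"
  assumes "\<And>x. x \<ge> x0 \<Longrightarrow> (fdiff ^^ Suc n) f x = 0"
  shows "\<exists>p. degree p \<le> n \<and> (\<forall>x\<ge>x0. poly p (of_int x) = f x)"
proof -
  obtain b :: "nat \<Rightarrow> 'a poly" where
    b: "\<And>k. degree (b k) \<le> k" "\<And>k z. poly (b k) z = ((z - of_int x0) gchoose k)"
    using ex_poly_gbinomial_shift[where 'a = 'a and c = "of_int x0"] by metis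
  let ?p = "\<Sum>j<Suc n. smult ((fdiff ^^ j) f x0) (b j)"
  have "degree ?p \<le> n"
  proof (rule degree_sum_le)
    fix j assume "j \<in> {..<Suc n}"
    then show "degree (smult ((fdiff ^^ j) f x0) (b j)) \<le> n"
      using degree_smult_le[of "(fdiff ^^ j) f x0" "b j"] b(1)[of j]
      by (meson le_trans lessThan_iff less_Suc_eq_le)
  qed simp
  moreover have "poly ?p (of_int x) = f x" if "x \<ge> x0" for x
    using newton_forward_difference[OF assms that]
    by (simp add: poly_sum b(2) del: funpow.simps sum.lessThan_Suc)
  ultimately show ?thesis by blast
qed

theorem theorem4p2:
  fixes x0 :: int and n :: nat
    and l0 s0 :: "int \<Rightarrow> 'a::real_normed_field"
  assumes "x0 \<ge> 0"
    and "n \<ge> 1"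
    and "\<forall>x\<ge>x0. sseq l0 s0 n x * lam l0 s0 (n - 1) x \<noteq> 0"
    and "\<forall>x\<ge>x0. lam l0 s0 (n - 1) x * sseq l0 s0 n x
                 - lam l0 s0 n x * sseq l0 s0 (n - 1) x = 0"
  shows "\<exists>p. polynomial_solution x0 l0 s0 p \<and> degree p \<le> n"
proof -
  obtain m where n: "n = Suc m"
    using \<open>n \<ge> 1\<close> by (cases n) auto
  define L where "L = lam l0 s0 m"
  define a where "a x = sseq l0 s0 m x / L x" for x
  define y where "y x = (\<Prod>i\<in>{x0..<x}. 1 - a i)" for x
  have L: "L x \<noteq> 0" and S: "sseq l0 s0 m x = a x * L x" if "x \<ge> x0" for x
    using assms(3) that by (auto simp: n L_def a_def)
  have riccati: "a (x + 1) + s0 x = a x + a x * l0 x + a x * a (x + 1)" if "x \<ge> x0" for x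
  proof -
    have "L x * sseq l0 s0 n x = L x * (a x * lam l0 s0 n x)"
      using assms(4) that S[OF that] by (simp add: n L_def del: lam.simps sseq.simps)
    then have "sseq l0 s0 n x = a x * lam l0 s0 n x"
      using L[OF that] by simp
    \<comment> \<open>After expansion \<open>- a x * L x\<close> occurs on both sides and cancels;
      \<open>L (x + 1)\<close> divides all that remains.\<close>
    then have "L (x + 1) * (a (x + 1) + s0 x) = L (x + 1) * (a x + a x * l0 x + a x * a (x + 1))"
      using S[of x] S[of "x + 1"] that
      by (simp add: n fdiff_def L_def[symmetric] algebra_simps)
    then show ?thesis
      using L[of "x + 1"] that by simp
  qed
  have y_Suc: "y (x + 1) = (1 - a x) * y x" if "x \<ge> x0" for x
  proof -
    have "{x0..<x + 1} = insert x {x0..<x}" using that by auto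
    then show ?thesis by (simp add: y_def)
  qed
  have dy: "fdiff y x = - a x * y x" if "x \<ge> x0" for x
    using y_Suc[OF that] by (simp add: fdiff_def algebra_simps)
  have sol: "solves_diff_eq x0 l0 s0 y"
    unfolding solves_diff_eq_def
  proof (intro allI impI)
    fix x assume x: "x \<ge> x0"
    have s0: "s0 x = a x + a x * l0 x + a x * a (x + 1) - a (x + 1)"
      using riccati[OF x] by (simp add: algebra_simps)
    have "fdiff (fdiff y) x = - a (x + 1) * ((1 - a x) * y x) + a x * y x"
      using dy[of x] dy[of "x + 1"] y_Suc[OF x] x by (simp add: fdiff_def[of "fdiff y"])
    also have "\<dots> = l0 x * fdiff y x + s0 x * y x"
      unfolding dy[OF x] s0 by (simp add: algebra_simps)
    finally show "fdiff (fdiff y) x = l0 x * fdiff y x + s0 x * y x" .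
  qed
  \<comment> \<open>\<open>Suc n\<close> is \<open>m + 2\<close>, so the coefficients are those of
    index \<open>m\<close>, and \<open>L x * (- a x * y x)\<close> cancels
    \<open>a x * L x * y x\<close>.\<close>
  have zero: "(fdiff ^^ Suc n) y x = 0" if "x \<ge> x0" for x
    using fdiff_iterate_solution[OF sol that, of m] dy[OF that] S[OF that]
    by (simp add: n L_def)
  obtain p where p: "degree p \<le> n" "\<And>x. x \<ge> x0 \<Longrightarrow> poly p (of_int x) = y x"
    using fdiff_iterate_zero_imp_poly[of x0 n y, OF zero] by blast
  have "solves_diff_eq x0 l0 s0 (\<lambda>x. poly p (of_int x))"
    using sol p(2) by (simp add: solves_diff_eq_def fdiff_def del: of_int_add)
  \<comment> \<open>At \<open>x0\<close> the product defining \<open>y\<close> is empty, hence 1; at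
    later points a factor \<open>1 - a i\<close> may vanish.\<close>
  moreover have "poly p (of_int x0) \<noteq> 0"
    using p(2)[of x0] by (simp add: y_def)
  ultimately show ?thesis
    using p(1) unfolding polynomial_solution_def by blast
qed

end
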